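(* Suppose that $\{\psi_n\}$ (weakly) separates $\mathfrak{A}$ from $\mathfrak{B}$. For $\{x_n\}\in\mathfrak{A}$, $\{y_n\}\in\mathfrak{B}$ let $E(\{x_n\},\{y_n\})\subset\Omega$ denote the set of probability one on which $\limsup_{n\to\infty}[\psi_n(x_n,\mathbb{X}_n)-\psi_n(y_n,\mathbb{X}_n)]<0$ holds, and write $E=\bigcap_{\{x_n\}\in\mathfrak{A},\,\{y_n\}\in\mathfrak{B}}E(\{x_n\},\{y_n\})$. For two sequences of statistics $\{\xi_n\}$ and $\{\eta_n\}$ valued in $\mathfrak{D}^*=\mathfrak{A}\cup\mathfrak{B}$, if $\psi_n(\xi_n,\mathbb{X}_n)\leqslant\psi_n(\eta_n,\mathbb{X}_n)$ for all $n$, then $$P\big(\{\xi_n\}\in\mathfrak{A}\big)-P\big(\{\eta_n\}\in\mathfrak{A}\big)\geqslant-P(\Omega\setminus E).$$ Furthermore, if $\mathfrak{A}$ and $\mathfrak{B}$ can be written as $\mathfrak{A}=\prod_{n=1}^\infty\mathfrak{A}_n$ and $\mathfrak{B}=\prod_{n=1}^\infty\mathfrak{B}_n$ with $\mathfrak{A}_n,\mathfrak{B}_n\subset\mathfrak{D}_n$, then for sufficiently large $n$, $$P(\xi_n\in\mathfrak{A}_n)-P(\eta_n\in\mathfrak{A}_n)\geqslant-P(\Omega\setminus E).$$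
   Context: Let $(\Omega,\mathfrak{F},P)$ be a probability space. All sets and maps (including $E$) are assumed measurable. For each $n\in\mathbb{N}$, the sample $\mathbb{X}_n$ is a map from $\Omega$ to a space $\mathcal{X}_n$, $\mathfrak{D}_n$ is a set (the decision space at sample size $n$), and the objective function $\psi_n$ is a map from $\mathfrak{D}_n\times\mathcal{X}_n$ to $\mathbb{R}$. Put $\mathfrak{D}=\prod_{n=1}^\infty\mathfrak{D}_n$; $\mathfrak{A},\mathfrak{B}$ are subsets of $\mathfrak{D}$ and $\mathfrak{D}^*=\mathfrak{A}\cup\mathfrak{B}$. A sequence of statistics $\{\xi_n\}$ valued in $\mathfrak{D}^*$ means that each $\xi_n$ is a measurable function of $\mathbb{X}_n$ valued in $\mathfrak{D}_n$ and the sequence $\{\xi_n(\omega)\}_{n\geq1}$ belongs to $\mathfrak{D}^*$ for every $\omega\in\Omega$. We say that $\{\psi_n\}$ (weakly) separates $\mathfrak{A}$ from $\mathfrak{B}$ if for all $\{x_n\}\in\mathfrak{A}$, $\{y_n\}\in\mathfrak{B}$, $\limsup_{n\to\infty}\left[\psi_n(x_n,\mathbb{X}_n)-\psi_n(y_n,\mathbb{X}_n)\right]<0$ almost surely.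
   Formalization: In the "Furthermore" part the set 𝔄 is assumed nonempty; without this the claim fails, e.g. ψ=0, 𝔄_1=∅, 𝔄_n={0} for n≥2, 𝔅_n={0,1}, ξ_n=1, η_n=0. *)

theory Defs
  imports "HOL-Probability.Probability"
begin

text \<open>
  The spaces \<open>D n\<close> and \<open>S n\<close> (decision and sample space at sample size \<open>n\<close>) are measurable spaces
  carried by subsets of common types, so that the product of the decision spaces is
  \<open>\<Pi>\<^sub>M n\<in>UNIV. D n\<close>. Sequences are indexed from 0 instead of 1.
\<close>

text \<open>The limit superior is taken in the extended reals, as the differences may be unbounded.\<close>

definition limsup_diff ::
  "(nat \<Rightarrow> 'd \<times> 'x \<Rightarrow> real) \<Rightarrow> (nat \<Rightarrow> 'w \<Rightarrow> 'x) \<Rightarrow> (nat \<Rightarrow> 'd) \<Rightarrow> (nat \<Rightarrow> 'd) \<Rightarrow> 'w \<Rightarrow> ereal"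
  where "limsup_diff \<psi> X x y \<omega> =
    limsup (\<lambda>n. ereal (\<psi> n (x n, X n \<omega>) - \<psi> n (y n, X n \<omega>)))"

definition weakly_separates ::
  "'w measure \<Rightarrow> (nat \<Rightarrow> 'w \<Rightarrow> 'x) \<Rightarrow> (nat \<Rightarrow> 'd \<times> 'x \<Rightarrow> real) \<Rightarrow>
    (nat \<Rightarrow> 'd) set \<Rightarrow> (nat \<Rightarrow> 'd) set \<Rightarrow> bool"
  where "weakly_separates M X \<psi> A B \<longleftrightarrow>
    (\<forall>x\<in>A. \<forall>y\<in>B. AE \<omega> in M. limsup_diff \<psi> X x y \<omega> < 0)"

definition sep_event ::
  "'w measure \<Rightarrow> (nat \<Rightarrow> 'w \<Rightarrow> 'x) \<Rightarrow> (nat \<Rightarrow> 'd \<times> 'x \<Rightarrow> real) \<Rightarrow>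
    (nat \<Rightarrow> 'd) \<Rightarrow> (nat \<Rightarrow> 'd) \<Rightarrow> 'w set"
  where "sep_event M X \<psi> x y = {\<omega> \<in> space M. limsup_diff \<psi> X x y \<omega> < 0}"

text \<open>
  Intersecting with \<open>space M\<close> only matters if \<open>A\<close> or \<open>B\<close> is empty: the empty intersection is the
  whole sample space.
\<close>

definition common_sep_event ::
  "'w measure \<Rightarrow> (nat \<Rightarrow> 'w \<Rightarrow> 'x) \<Rightarrow> (nat \<Rightarrow> 'd \<times> 'x \<Rightarrow> real) \<Rightarrow>
    (nat \<Rightarrow> 'd) set \<Rightarrow> (nat \<Rightarrow> 'd) set \<Rightarrow> 'w set"
  where "common_sep_event M X \<psi> A B =
    space M \<inter> (\<Inter>x\<in>A. \<Inter>y\<in>B. sep_event M X \<psi> x y)"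

definition statistics_in ::
  "'w measure \<Rightarrow> (nat \<Rightarrow> 'x measure) \<Rightarrow> (nat \<Rightarrow> 'd measure) \<Rightarrow> (nat \<Rightarrow> 'w \<Rightarrow> 'x) \<Rightarrow>
    (nat \<Rightarrow> 'd) set \<Rightarrow> (nat \<Rightarrow> 'w \<Rightarrow> 'd) \<Rightarrow> bool"
  where "statistics_in M S D X C \<xi> \<longleftrightarrow>
    (\<forall>n. \<exists>h \<in> S n \<rightarrow>\<^sub>M D n. \<forall>\<omega>\<in>space M. \<xi> n \<omega> = h (X n \<omega>)) \<and>
    (\<forall>\<omega>\<in>space M. (\<lambda>n. \<xi> n \<omega>) \<in> C)"

end

theory Submission
  imports Defs
begin

text \<open>
  Fix an outcome \<open>\<omega> \<in> E\<close>. If \<open>\<eta>(\<omega>)\<close> lay in \<open>A\<close> but \<open>\<xi>(\<omega>)\<close> did not, then \<open>\<xi>(\<omega>)\<close> would lie in \<open>B\<close>, and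
  since \<open>E\<close> is contained in the separation event of \<^emph>\<open>every\<close> pair, it may be applied to the random
  pair \<open>(\<eta>(\<omega>), \<xi>(\<omega>))\<close>: the objective at \<open>\<eta>(\<omega>)\<close> would eventually be strictly below the one at
  \<open>\<xi>(\<omega>)\<close>, whereas \<open>\<xi>\<close> is at least as good as \<open>\<eta>\<close>. Hence \<open>{\<eta> \<in> A} \<inter> E \<subseteq> {\<xi> \<in> A}\<close>, and
  subadditivity of the probability gives the first bound.

  For nonempty products \<open>A = \<Prod> A\<^sub>n\<close>, \<open>B = \<Prod> B\<^sub>n\<close> one might expect an index beyond which separation holds
  that depends on \<open>\<omega>\<close>, and hence only an asymptotic bound. This is avoided: one single
  outcome in \<open>E\<close> already forces \<open>A\<^sub>n \<inter> B\<^sub>n = {}\<close> for all large \<open>n\<close>, a statement without \<open>\<omega>\<close>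
  (lemma \<open>eventually_disjoint_factors\<close>). From then on a sequence in \<open>A \<union> B\<close> reveals by its \<open>n\<close>-th
  entry alone which of the two sets contains it, so the events \<open>{\<xi>\<^sub>n \<in> A\<^sub>n}\<close> and \<open>{\<xi> \<in> A}\<close> coincide,
  likewise for \<open>\<eta>\<close>, and the second bound is the first one. If \<open>E\<close> is empty, the bound is \<open>-1\<close> and
  holds trivially; if \<open>B\<close> is empty, both statistics always take values in \<open>A\<close>.
\<close>

lemma eventually_less_if_limsup_diff_neg:
  assumes "limsup_diff \<psi> X x y \<omega> < 0"
  shows "\<forall>\<^sub>F n in sequentially. \<psi> n (x n, X n \<omega>) < \<psi> n (y n, X n \<omega>)"
proof -
  have "\<forall>\<^sub>F n in sequentially. ereal (\<psi> n (x n, X n \<omega>) - \<psi> n (y n, X n \<omega>)) < 0"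
    using assms unfolding limsup_diff_def by (rule Limsup_lessD)
  then show ?thesis
    by eventually_elim (simp flip: zero_ereal_def)
qed

lemma limsup_diff_neg_if_common_sep_event:
  assumes "\<omega> \<in> common_sep_event M X \<psi> A B" "x \<in> A" "y \<in> B"
  shows "limsup_diff \<psi> X x y \<omega> < 0"
  using assms unfolding common_sep_event_def sep_event_def by blast

text \<open>
  The pathwise form of the theorem: on the common separation event, lowering the objective never
  leads out of \<open>A\<close>. Here \<open>x\<close> and \<open>y\<close> may be chosen after \<open>\<omega>\<close>.
\<close>

lemma in_better_set_if_objective_le:
  assumes "\<omega> \<in> common_sep_event M X \<psi> A B"
    and "x \<in> A" "y \<in> A \<union> B"
    and le: "\<And>n. \<psi> n (y n, X n \<omega>) \<le> \<psi> n (x n, X n \<omega>)"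
  shows "y \<in> A"
proof (rule ccontr)
  assume "y \<notin> A"
  then have "limsup_diff \<psi> X x y \<omega> < 0"
    using assms by (auto intro: limsup_diff_neg_if_common_sep_event)
  then have "\<forall>\<^sub>F n in sequentially. \<psi> n (x n, X n \<omega>) < \<psi> n (y n, X n \<omega>)"
    by (rule eventually_less_if_limsup_diff_neg)
  then have "\<forall>\<^sub>F n in sequentially. False"
    by eventually_elim (use le in \<open>simp add: leD\<close>)
  then show False by simp
qed

text \<open>
  If infinitely many factors had a common point, then two sequences in the two products could agree
  at these indices; their objective values would agree there too, for any outcome, and so no
  outcome would lie in the common separation event.
\<close>

lemma eventually_disjoint_factors:
  assumes "common_sep_event M X \<psi> (Pi UNIV A') (Pi UNIV B') \<noteq> {}"
    and "Pi UNIV A' \<noteq> {}" "Pi UNIV B' \<noteq> {}"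
  shows "\<forall>\<^sub>F n in sequentially. A' n \<inter> B' n = {}"
proof -
  obtain \<omega> where \<omega>: "\<omega> \<in> common_sep_event M X \<psi> (Pi UNIV A') (Pi UNIV B')"
    using assms(1) by blast
  obtain a b where a: "a \<in> Pi UNIV A'" and b: "b \<in> Pi UNIV B'"
    using assms(2,3) by blast
  \<comment> \<open>Common points are inserted into \<open>a\<close> and \<open>b\<close> wherever they exist.\<close>
  define c where "c n = (SOME z. z \<in> A' n \<inter> B' n)" for n
  define x where "x n = (if A' n \<inter> B' n = {} then a n else c n)" for n
  define y where "y n = (if A' n \<inter> B' n = {} then b n else c n)" for n
  have c: "c n \<in> A' n \<inter> B' n" if "A' n \<inter> B' n \<noteq> {}" for n
    unfolding c_def using that by (intro some_in_eq[THEN iffD2])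
  have "x \<in> Pi UNIV A'" "y \<in> Pi UNIV B'"
    using a b c unfolding x_def y_def by auto
  with \<omega> have "limsup_diff \<psi> X x y \<omega> < 0"
    by (rule limsup_diff_neg_if_common_sep_event)
  then have "\<forall>\<^sub>F n in sequentially. \<psi> n (x n, X n \<omega>) < \<psi> n (y n, X n \<omega>)"
    by (rule eventually_less_if_limsup_diff_neg)
  then show ?thesis
    by eventually_elim (auto simp: x_def y_def split: if_splits)
qed

lemma eventually_factor_decides_membership:
  assumes "common_sep_event M X \<psi> (Pi UNIV A') (Pi UNIV B') \<noteq> {}"
    and "Pi UNIV A' \<noteq> {}"
  shows "\<forall>\<^sub>F n in sequentially.
    \<forall>z \<in> Pi UNIV A' \<union> Pi UNIV B'. z n \<in> A' n \<longleftrightarrow> z \<in> Pi UNIV A'"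
proof (cases "Pi UNIV B' = {}")
  case True
  show ?thesis unfolding True by (auto intro: always_eventually)
next
  case False
  from eventually_disjoint_factors[OF assms False] show ?thesis
    by eventually_elim blast
qed

lemma statistics_in_sequence_measurable:
  assumes "\<And>n. X n \<in> M \<rightarrow>\<^sub>M S n" "statistics_in M S D X C \<xi>"
  shows "(\<lambda>\<omega> n. \<xi> n \<omega>) \<in> M \<rightarrow>\<^sub>M (\<Pi>\<^sub>M n\<in>UNIV. D n)"
proof -
  have "\<xi> n \<in> M \<rightarrow>\<^sub>M D n" for n
  proof -
    obtain h where h: "h \<in> S n \<rightarrow>\<^sub>M D n" "\<forall>\<omega>\<in>space M. \<xi> n \<omega> = h (X n \<omega>)"
      using assms(2) unfolding statistics_in_def by blast
    have "(\<lambda>\<omega>. h (X n \<omega>)) \<in> M \<rightarrow>\<^sub>M D n"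
      using assms(1) h(1) by (rule measurable_compose)
    then show ?thesis
      using h(2) by (simp cong: measurable_cong)
  qed
  then show ?thesis
    by (intro measurable_PiM_single') (auto dest: measurable_space)
qed

text \<open>
  An inclusion that may fail outside \<open>E\<close> becomes a true one when the complement of \<open>E\<close> is added to
  the larger event; subadditivity then bounds the loss.
\<close>

lemma (in prob_space) prob_diff_ge_of_inclusion_on:
  assumes "F \<in> events" "E \<in> events" "G \<inter> E \<subseteq> F" "G \<subseteq> space M"
  shows "prob F - prob G \<ge> - prob (space M - E)"
proof -
  have "prob G \<le> prob (F \<union> (space M - E))"
    using assms by (intro finite_measure_mono) auto
  also have "\<dots> \<le> prob F + prob (space M - E)"
    using assms by (intro measure_Un_le) auto
  finally show ?thesis by simp
qed

theorem theorem3p6: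
  fixes M :: "'w measure"
    and S :: "nat \<Rightarrow> 'x measure"
    and D :: "nat \<Rightarrow> 'd measure"
    and X :: "nat \<Rightarrow> 'w \<Rightarrow> 'x"
    and \<psi> :: "nat \<Rightarrow> 'd \<times> 'x \<Rightarrow> real"
    and A B :: "(nat \<Rightarrow> 'd) set"
    and \<xi> \<eta> :: "nat \<Rightarrow> 'w \<Rightarrow> 'd"
    and E :: "'w set"
  assumes "prob_space M"
    and "\<And>n. X n \<in> M \<rightarrow>\<^sub>M S n"
    and "\<And>n. \<psi> n \<in> borel_measurable (D n \<Otimes>\<^sub>M S n)"
    and "A \<in> sets (\<Pi>\<^sub>M n\<in>UNIV. D n)"
    and "B \<in> sets (\<Pi>\<^sub>M n\<in>UNIV. D n)"
    and "weakly_separates M X \<psi> A B"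
    and "E = common_sep_event M X \<psi> A B"
    and "E \<in> sets M"
    and "statistics_in M S D X (A \<union> B) \<xi>"
    and "statistics_in M S D X (A \<union> B) \<eta>"
    and "\<And>n \<omega>. \<omega> \<in> space M \<Longrightarrow> \<psi> n (\<xi> n \<omega>, X n \<omega>) \<le> \<psi> n (\<eta> n \<omega>, X n \<omega>)"
  shows "\<P>(\<omega> in M. (\<lambda>n. \<xi> n \<omega>) \<in> A) - \<P>(\<omega> in M. (\<lambda>n. \<eta> n \<omega>) \<in> A)
           \<ge> - measure M (space M - E) \<and>
         (\<forall>A' B'. (\<forall>n. A' n \<in> sets (D n)) \<longrightarrow> (\<forall>n. B' n \<in> sets (D n)) \<longrightarrow>
            A = Pi UNIV A' \<longrightarrow> B = Pi UNIV B' \<longrightarrow> A \<noteq> {} \<longrightarrow>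
            (\<forall>\<^sub>F n in sequentially.
               \<P>(\<omega> in M. \<xi> n \<omega> \<in> A' n) - \<P>(\<omega> in M. \<eta> n \<omega> \<in> A' n)
                 \<ge> - measure M (space M - E)))"
proof -
  interpret prob_space M by fact
  have in_C: "(\<lambda>n. \<xi> n \<omega>) \<in> A \<union> B" "(\<lambda>n. \<eta> n \<omega>) \<in> A \<union> B" if "\<omega> \<in> space M" for \<omega>
    using assms(9,10) that unfolding statistics_in_def by auto
  have bound: "\<P>(\<omega> in M. (\<lambda>n. \<xi> n \<omega>) \<in> A) - \<P>(\<omega> in M. (\<lambda>n. \<eta> n \<omega>) \<in> A)
      \<ge> - measure M (space M - E)"
  proof (rule prob_diff_ge_of_inclusion_on)
    show "{\<omega> \<in> space M. (\<lambda>n. \<xi> n \<omega>) \<in> A} \<in> events"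
      using measurable_sets[OF statistics_in_sequence_measurable[OF assms(2,9)] assms(4)]
      by (simp add: vimage_def Int_def conj_commute)
    show "{\<omega> \<in> space M. (\<lambda>n. \<eta> n \<omega>) \<in> A} \<inter> E \<subseteq> {\<omega> \<in> space M. (\<lambda>n. \<xi> n \<omega>) \<in> A}"
    proof
      fix \<omega> assume "\<omega> \<in> {\<omega> \<in> space M. (\<lambda>n. \<eta> n \<omega>) \<in> A} \<inter> E"
      then have \<omega>: "\<omega> \<in> space M" "(\<lambda>n. \<eta> n \<omega>) \<in> A" "\<omega> \<in> common_sep_event M X \<psi> A B"
        using assms(7) by auto
      have "(\<lambda>n. \<xi> n \<omega>) \<in> A"
        using \<omega>(3,2) in_C(1)[OF \<omega>(1)] assms(11)[OF \<omega>(1)] by (rule in_better_set_if_objective_le)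
      with \<omega>(1) show "\<omega> \<in> {\<omega> \<in> space M. (\<lambda>n. \<xi> n \<omega>) \<in> A}" by simp
    qed
  qed (use assms(8) in auto)
  moreover have "\<forall>\<^sub>F n in sequentially.
      \<P>(\<omega> in M. \<xi> n \<omega> \<in> A' n) - \<P>(\<omega> in M. \<eta> n \<omega> \<in> A' n) \<ge> - measure M (space M - E)"
    if A: "A = Pi UNIV A'" and B: "B = Pi UNIV B'" and "A \<noteq> {}" for A' B'
  proof (cases "E = {}")
    case True
    have "- 1 \<le> prob F - prob G" for F G
      using prob_le_1[of G] measure_nonneg[of M F] by linarith
    then show ?thesis using True by (simp add: prob_space)
  next
    case False
    then have "\<forall>\<^sub>F n in sequentially. \<forall>z \<in> A \<union> B. z n \<in> A' n \<longleftrightarrow> z \<in> A"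
      using eventually_factor_decides_membership[of M X \<psi> A' B'] assms(7) that by simp
    then show ?thesis
    proof eventually_elim
      case (elim n)
      have "{\<omega> \<in> space M. \<xi> n \<omega> \<in> A' n} = {\<omega> \<in> space M. (\<lambda>n. \<xi> n \<omega>) \<in> A}"
        and "{\<omega> \<in> space M. \<eta> n \<omega> \<in> A' n} = {\<omega> \<in> space M. (\<lambda>n. \<eta> n \<omega>) \<in> A}"
        using elim in_C by fastforce+
      with bound show ?case by simp
    qed
  qed
  ultimately show ?thesis by blast
qed

end
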